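(* Let $M \in \mathrm{Sp}(2n;\mathbb{R})$ be a symplectic matrix whose $2n$ (complex) eigenvalues are mutually distinct. Let $G_1, G_2 \in \mathbb{R}^{2n\times 2n}$ be symmetric positive definite matrices with $M G_i M^{tr} = G_i$ for $i = 1,2$. For $i=1,2$ let $G_i = S_i^{tr} D_i S_i$ with $S_i \in \mathrm{Sp}(2n;\mathbb{R})$ and $D_i = \mathrm{diag}(\Lambda_i,\Lambda_i)$, where $\Lambda_i \in \mathbb{R}^{n\times n}$ is diagonal. Then $S_2 S_1^{-1} \in SO(2n;\mathbb{R})$.
   Context: $J = \begin{pmatrix} 0 & 1_n \\ -1_n & 0\end{pmatrix} \in \mathbb{R}^{2n\times 2n}$, and $\mathrm{Sp}(2n;\mathbb{R})$ is the group of real $2n \times 2n$ matrices $S$ with $S^{tr} J S = J$. The superscript $tr$ denotes the transpose. *)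

theory Defs
  imports
    "Jordan_Normal_Form.Spectral_Radius"
    "Jordan_Normal_Form.Gauss_Jordan_Elimination"
    "Jordan_Normal_Form.Determinant"
begin

definition symplectic_J :: "nat \<Rightarrow> real mat" where
  "symplectic_J n = four_block_mat (0\<^sub>m n n) (1\<^sub>m n) (- 1\<^sub>m n) (0\<^sub>m n n)"

definition Sp :: "nat \<Rightarrow> real mat set" where
  "Sp n = {S \<in> carrier_mat (2 * n) (2 * n).
             transpose_mat S * symplectic_J n * S = symplectic_J n}"

(* The index of Sp is half the matrix size, as forced by the block form of J;
   the index of SO is the matrix size itself.  orthogonal_mat of the library is
   not usable here, since it only asks for orthogonal nonzero columns. *)
definition SO :: "nat \<Rightarrow> real mat set" where
  "SO m = {A \<in> carrier_mat m m. transpose_mat A * A = 1\<^sub>m m \<and> det A = 1}"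

definition sym_pos_def :: "nat \<Rightarrow> real mat \<Rightarrow> bool" where
  "sym_pos_def m G \<longleftrightarrow> G \<in> carrier_mat m m \<and> transpose_mat G = G \<and>
     (\<forall>v \<in> carrier_vec m. v \<noteq> 0\<^sub>v m \<longrightarrow> v \<bullet> (G *\<^sub>v v) > 0)"

definition diag_twice :: "real mat \<Rightarrow> real mat" where
  "diag_twice L = four_block_mat L (0\<^sub>m (dim_row L) (dim_col L)) (0\<^sub>m (dim_row L) (dim_col L)) L"

(* mat_inverse returns None exactly for non-invertible matrices, so this is the
   actual inverse on every invertible square matrix, in particular on Sp n. *)
definition inv_mat :: "real mat \<Rightarrow> real mat" where
  "inv_mat A = the (mat_inverse A)"

end

theory Submission
  imports Defs
begin

text \<open>Since \<open>M G J = M G M\<^sup>T J M = G J M\<close>, both \<open>G\<^sub>1 J\<close> and \<open>G\<^sub>2 J\<close> commute with \<open>M\<close>, hence with each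
  other because \<open>M\<close> has simple spectrum. Put \<open>P\<^sub>i = S\<^sub>i\<^sup>T S\<^sub>i\<close>. Up to conjugation by \<open>S\<^sub>i\<^sup>T\<close>, the matrix
  \<open>G\<^sub>i J\<close> is \<open>D\<^sub>i J\<close> and \<open>P\<^sub>i J\<close> is \<open>J\<close>. A matrix commuting with \<open>D\<^sub>i J\<close> commutes with its square
  \<open>-D\<^sub>i\<^sup>2\<close>, hence with the positive diagonal matrix \<open>D\<^sub>i\<close> and with \<open>J\<close>. So \<open>P\<^sub>1 J\<close> and \<open>P\<^sub>2 J\<close> commute as
  well, and both square to \<open>-1\<close>. Thus \<open>-(P\<^sub>1 J)(P\<^sub>2 J) = P\<^sub>1 (J\<^sup>T P\<^sub>2 J)\<close> is an involution that is a
  product of two positive definite matrices; it has no eigenvalue \<open>-1\<close>, so it is the identity and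
  \<open>P\<^sub>1 = P\<^sub>2\<close>. This says that \<open>S\<^sub>2 S\<^sub>1\<^sup>-\<^sup>1\<close> is orthogonal.\<close>

lemma commute_diag_entry:
  fixes A :: "'a :: idom mat"
  assumes A: "A \<in> carrier_mat m m" and comm: "A * mat_diag m f = mat_diag m f * A"
    and ij: "i < m" "j < m" and ne: "f i \<noteq> f j"
  shows "A $$ (i,j) = 0"
proof -
  have "(A * mat_diag m f) $$ (i,j) = (mat_diag m f * A) $$ (i,j)"
    using comm by simp
  then have "A $$ (i,j) * f j = f i * A $$ (i,j)"
    using ij by (simp add: mat_diag_mult_left[OF A] mat_diag_mult_right[OF A])
  then show ?thesis using ne by (simp add: mult.commute)
qed

text \<open>Converse of the previous lemma. Together they transfer commutation from one diagonal
  matrix to another whose entries coincide wherever those of the first do.\<close>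

lemma commute_diag_if:
  fixes A :: "'a :: idom mat"
  assumes A: "A \<in> carrier_mat m m"
    and zero: "\<And>i j. i < m \<Longrightarrow> j < m \<Longrightarrow> f i \<noteq> f j \<Longrightarrow> A $$ (i,j) = 0"
  shows "A * mat_diag m f = mat_diag m f * A"
  unfolding mat_diag_mult_left[OF A] mat_diag_mult_right[OF A]
  using zero by (intro eq_matI) (auto simp: mult.commute)

lemma eq_mat_diag_if_commute:
  fixes A :: "'a :: idom mat"
  assumes A: "A \<in> carrier_mat m m" and comm: "A * mat_diag m f = mat_diag m f * A"
    and inj: "inj_on f {..<m}"
  shows "A = mat_diag m (\<lambda>i. A $$ (i,i))"
  using A commute_diag_entry[OF A comm] inj
  by (intro eq_matI) (auto simp: mat_diag_def inj_on_def)

section \<open>Diagonalization of complex matrices with simple spectrum\<close>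

lemma jordan_matrix_unit_blocks:
  assumes "\<forall>x \<in> set xs. fst x = 1"
  shows "jordan_matrix xs = mat_diag (length xs) (\<lambda>i. snd (xs ! i))"
  using assms
proof (induct xs)
  case Nil
  then show ?case by (auto simp: jordan_matrix_def mat_diag_def)
next
  case (Cons x xs)
  obtain a where x: "x = (1, a)" using Cons(2) by (cases x) auto
  have "jordan_matrix (x # xs) = four_block_mat (jordan_block 1 a)
      (0\<^sub>m 1 (length xs)) (0\<^sub>m (length xs) 1) (jordan_matrix xs)"
    using Cons by (auto simp: jordan_matrix_def x Let_def mat_diag_def)
  also have "\<dots> = mat_diag (length (x # xs)) (\<lambda>i. snd ((x # xs) ! i))"
    using Cons by (intro eq_matI) (auto simp: mat_diag_def x nth_Cons' less_Suc_eq_0_disj split: if_splits)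
  finally show ?case .
qed

lemma length_le_sum_list:
  fixes f :: "'a \<Rightarrow> nat"
  assumes "\<forall>x \<in> set xs. f x \<ge> 1"
  shows "length xs \<le> sum_list (map f xs)"
proof -
  have "sum_list (map (\<lambda>_. 1) xs) \<le> sum_list (map f xs)"
    using assms by (intro sum_list_mono) simp
  then show ?thesis by (simp add: sum_list_triv)
qed

text \<open>Meant for Jordan block sizes: if there are as many blocks as dimensions, every block has
  size one.\<close>

lemma eq_one_if_sum_list_eq_length:
  fixes f :: "'a \<Rightarrow> nat"
  assumes "\<forall>x \<in> set xs. f x \<ge> 1" and "sum_list (map f xs) = length xs"
  shows "\<forall>x \<in> set xs. f x = 1"
  using assms
proof (induct xs)
  case (Cons x xs)
  have le: "length xs \<le> sum_list (map f xs)" using Cons(2) by (intro length_le_sum_list) simp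
  have x: "f x \<ge> 1" using Cons(2) by simp
  have sum: "f x + sum_list (map f xs) = Suc (length xs)" using Cons(3) by simp
  have "f x = 1" "sum_list (map f xs) = length xs" using le x sum by linarith+
  moreover from Cons(1)[OF _ this(2)] Cons(2) have "\<forall>x \<in> set xs. f x = 1" by simp
  ultimately show ?case by simp
qed simp

text \<open>Each of the \<open>m\<close> eigenvalues needs a Jordan block of its own, and the block
  sizes add up to \<open>m\<close>, so the Jordan form is diagonal with distinct entries.\<close>

lemma diagonalizable_if_distinct_eigenvalues:
  fixes A :: "complex mat"
  assumes A: "A \<in> carrier_mat m m" and card: "card (spectrum A) = m"
  obtains P Q f where "P \<in> carrier_mat m m" "Q \<in> carrier_mat m m"
    "P * Q = 1\<^sub>m m" "Q * P = 1\<^sub>m m" "A = P * mat_diag m f * Q" "inj_on f {..<m}"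
proof -
  from char_poly_factorized[OF A] obtain as where "char_poly A = (\<Prod>a\<leftarrow>as. [:- a, 1:])" by auto
  from jordan_nf_exists[OF A this] obtain xs where nf: "jordan_nf A xs" ..
  then obtain P Q where wit: "similar_mat_wit A (jordan_matrix xs) P Q"
    by (auto simp: jordan_nf_def similar_mat_def)
  note W = similar_mat_witD2[OF A wit]
  have pos: "\<forall>x \<in> set xs. fst x \<ge> 1" using nf by (force simp: jordan_nf_def)
  have size: "sum_list (map fst xs) = m" using W(5) by auto
  have "spectrum A \<subseteq> set (map snd xs)"
    unfolding spectrum_root_char_poly[OF A] jordan_nf_char_poly[OF nf]
    by (force simp: poly_prod_list prod_list_zero_iff)
  from card_mono[OF _ this] card have le: "m \<le> card (set (map snd xs))" by simp
  have len: "length xs \<le> sum_list (map fst xs)" using pos by (rule length_le_sum_list)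
  \<comment> \<open>The chain \<open>m\<close> \<le> number of distinct block eigenvalues \<le>
    number of blocks \<le> sum of block sizes = \<open>m\<close> collapses to equalities.\<close>
  have card_eq: "card (set (map snd xs)) = length (map snd xs)" and length: "length xs = m"
    using le len size card_length[of "map snd xs"] by auto
  have dist: "distinct (map snd xs)" using card_eq by (rule card_distinct)
  have "\<forall>x \<in> set xs. fst x = 1"
    using pos size length by (intro eq_one_if_sum_list_eq_length) auto
  from jordan_matrix_unit_blocks[OF this] length
  have "A = P * mat_diag m (\<lambda>i. snd (xs ! i)) * Q" using W(3) by simp
  moreover have "inj_on (\<lambda>i. snd (xs ! i)) {..<m}"
    using dist length by (auto simp: inj_on_def distinct_conv_nth)
  ultimately show thesis by (rule that[OF W(6,7,1,2)])
qed

section \<open>Conjugation, and commutants of matrices with simple spectrum\<close>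

lemma uminus_mult_square_mat:
  fixes A B :: "'a :: ring mat"
  assumes "A \<in> carrier_mat m m" "B \<in> carrier_mat m m"
  shows "- A * B = - (A * B)" "A * - B = - (A * B)"
  using assms by auto

text \<open>The general rules have carrier conditions in several dimensions; fixing one common
  dimension \<open>m\<close> lets the simplifier discharge them.\<close>

lemmas square_mat_simps =
  assoc_mult_mat[of _ m m _ m _ m for m] mult_carrier_mat[of _ m m _ m for m]
  left_mult_one_mat[of _ m m for m] right_mult_one_mat[of _ m m for m]
  uminus_mult_square_mat[of _ m for m]

text \<open>The inner factor \<open>P * Q\<close> cancels, so the map sending \<open>X\<close> to
  \<open>Q * X * P\<close> is multiplicative.\<close>

lemma conjugate_commute:
  fixes A B P Q :: "'a :: semiring_1 mat"
  assumes c: "A \<in> carrier_mat m m" "B \<in> carrier_mat m m" "P \<in> carrier_mat m m" "Q \<in> carrier_mat m m"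
    and PQ: "P * Q = 1\<^sub>m m" and comm: "A * B = B * A"
  shows "(Q * A * P) * (Q * B * P) = (Q * B * P) * (Q * A * P)"
proof -
  have *: "(Q * X * P) * (Q * Y * P) = Q * (X * Y) * P"
    if "X \<in> carrier_mat m m" "Y \<in> carrier_mat m m" for X Y
  proof -
    have "(Q * X * P) * (Q * Y * P) = Q * X * (P * Q) * Y * P"
      using c that by (simp add: square_mat_simps[of _ m])
    then show ?thesis using c that by (simp add: PQ square_mat_simps[of _ m])
  qed
  show ?thesis unfolding *[OF c(1,2)] *[OF c(2,1)] comm ..
qed

lemma conjugate_inverse:
  fixes X P Q :: "'a :: semiring_1 mat"
  assumes c: "X \<in> carrier_mat m m" "P \<in> carrier_mat m m" "Q \<in> carrier_mat m m"
    and PQ: "P * Q = 1\<^sub>m m"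
  shows "P * (Q * X * P) * Q = X"
proof -
  have "P * (Q * X * P) * Q = (P * Q) * X * (P * Q)"
    using c by (simp add: square_mat_simps[of _ m])
  then show ?thesis using c by (simp add: PQ)
qed

text \<open>In an eigenbasis of \<open>A\<close> both \<open>B\<close> and \<open>C\<close> become
  diagonal, and diagonal matrices commute.\<close>

lemma commute_if_commute_distinct_eigenvalues:
  fixes A B C :: "complex mat"
  assumes A: "A \<in> carrier_mat m m" and card: "card (spectrum A) = m"
    and B: "B \<in> carrier_mat m m" and C: "C \<in> carrier_mat m m"
    and AB: "A * B = B * A" and AC: "A * C = C * A"
  shows "B * C = C * B"
proof -
  from diagonalizable_if_distinct_eigenvalues[OF A card] obtain P Q f where
    P: "P \<in> carrier_mat m m" and Q: "Q \<in> carrier_mat m m"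
    and PQ: "P * Q = 1\<^sub>m m" and QP: "Q * P = 1\<^sub>m m"
    and A_eq: "A = P * mat_diag m f * Q" and inj: "inj_on f {..<m}" .
  have QAP: "Q * A * P = mat_diag m f"
    unfolding A_eq using conjugate_inverse[OF _ Q P QP] by simp
  have diag: "\<exists>g. Q * X * P = mat_diag m g" if "X \<in> carrier_mat m m" "A * X = X * A" for X
  proof
    show "Q * X * P = mat_diag m (\<lambda>i. (Q * X * P) $$ (i,i))"
      by (rule eq_mat_diag_if_commute[OF _ _ inj])
        (use conjugate_commute[OF that(1) A P Q PQ that(2)[symmetric]] P Q that QAP in auto)
  qed
  obtain g h where g: "Q * B * P = mat_diag m g" and h: "Q * C * P = mat_diag m h"
    using diag[OF B AB] diag[OF C AC] by auto
  have "(Q * B * P) * (Q * C * P) = (Q * C * P) * (Q * B * P)"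
    unfolding g h by (simp add: mult.commute)
  \<comment> \<open>Change back to the original basis, with the roles of \<open>P\<close> and
    \<open>Q\<close> exchanged.\<close>
  then have "(P * (Q * B * P) * Q) * (P * (Q * C * P) * Q) = (P * (Q * C * P) * Q) * (P * (Q * B * P) * Q)"
    by (intro conjugate_commute[OF _ _ Q P QP]) (use P Q B C in auto)
  then show ?thesis using conjugate_inverse[OF _ P Q PQ] B C by simp
qed

text \<open>The eigenvalues may be non-real, so the argument runs over the complex numbers; the
  entrywise embedding is multiplicative and injective, which brings the result back.\<close>

lemma real_commute_if_commute_distinct_eigenvalues:
  fixes A B C :: "real mat"
  assumes A: "A \<in> carrier_mat m m"
    and card: "card (spectrum (map_mat complex_of_real A)) = m"
    and B: "B \<in> carrier_mat m m" and C: "C \<in> carrier_mat m m"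
    and AB: "A * B = B * A" and AC: "A * C = C * A"
  shows "B * C = C * B"
proof -
  have hm: "map_mat complex_of_real (X * Y) = map_mat complex_of_real X * map_mat complex_of_real Y"
    if "X \<in> carrier_mat m m" "Y \<in> carrier_mat m m" for X Y
    using of_real_hom.mat_hom_mult[OF that] .
  have "map_mat complex_of_real (B * C) = map_mat complex_of_real (C * B)"
    unfolding hm[OF B C] hm[OF C B]
  proof (rule commute_if_commute_distinct_eigenvalues[OF _ card])
    show "map_mat complex_of_real A * map_mat complex_of_real B
        = map_mat complex_of_real B * map_mat complex_of_real A"
      by (simp only: hm[OF A B, symmetric] hm[OF B A, symmetric] AB)
    show "map_mat complex_of_real A * map_mat complex_of_real C
        = map_mat complex_of_real C * map_mat complex_of_real A"
      by (simp only: hm[OF A C, symmetric] hm[OF C A, symmetric] AC)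
  qed (use A B C in auto)
  then show ?thesis by (rule of_real_hom.mat_hom_inj)
qed

section \<open>The matrix \<open>J\<close> and the symplectic group\<close>

lemma symplectic_J_carrier [simp]: "symplectic_J n \<in> carrier_mat (2 * n) (2 * n)"
  by (auto simp: symplectic_J_def mult_2)

lemma symplectic_J_squared: "symplectic_J n * symplectic_J n = - 1\<^sub>m (2 * n)"
  unfolding symplectic_J_def
  by (subst mult_four_block_mat[of _ n n _ n _ n _ _ n _ n]) (auto simp: mult_2 intro!: eq_matI)

lemma transpose_symplectic_J: "transpose_mat (symplectic_J n) = - symplectic_J n"
  unfolding symplectic_J_def by (intro eq_matI) auto

text \<open>Both products equal the block matrix [[0, L], [-L, 0]], because the two diagonal blocks
  agree.\<close>

lemma symplectic_J_commute_diag_twice: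
  assumes "L \<in> carrier_mat n n"
  shows "diag_twice L * symplectic_J n = symplectic_J n * diag_twice L"
  using assms unfolding symplectic_J_def diag_twice_def
  by (auto simp: mult_four_block_mat[of _ n n _ n _ n _ _ n _ n] intro!: eq_matI)

lemma Sp_carrier: "S \<in> Sp n \<Longrightarrow> S \<in> carrier_mat (2 * n) (2 * n)"
  by (simp add: Sp_def)

text \<open>The inverse is explicit: the symplectic relation and \<open>J * J = -1\<close> show that
  minus \<open>J * transpose_mat S * J\<close> is a left inverse.\<close>

lemma Sp_inverse:
  assumes "S \<in> Sp n"
  obtains T where "T \<in> carrier_mat (2 * n) (2 * n)" "S * T = 1\<^sub>m (2 * n)" "T * S = 1\<^sub>m (2 * n)"
proof -
  let ?m = "2 * n" and ?J = "symplectic_J n"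
  have S: "S \<in> carrier_mat ?m ?m" and SJS: "transpose_mat S * ?J * S = ?J"
    using assms by (auto simp: Sp_def)
  let ?T = "- (?J * transpose_mat S * ?J)"
  have J: "?J \<in> carrier_mat ?m ?m" by simp
  have T: "?T \<in> carrier_mat ?m ?m" using S by (simp add: square_mat_simps[of _ ?m])
  have "?T * S = - (?J * (transpose_mat S * ?J * S))"
    using S J by (simp add: square_mat_simps[of _ ?m])
  also have "\<dots> = 1\<^sub>m ?m" by (simp add: SJS symplectic_J_squared)
  finally have "?T * S = 1\<^sub>m ?m" .
  with mat_mult_left_right_inverse[OF T S this] T that show thesis by blast
qed

text \<open>With \<open>T\<close> the inverse of \<open>S\<close>, the symplectic relation reads
  \<open>transpose_mat S * J = J * T\<close>. Multiplying by \<open>S * J\<close> on the left gives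
  \<open>-1\<close>, and cancelling the last \<open>J\<close> gives the claim.\<close>

lemma Sp_transpose:
  assumes "S \<in> Sp n"
  shows "transpose_mat S \<in> Sp n"
proof -
  let ?m = "2 * n" and ?J = "symplectic_J n"
  have S: "S \<in> carrier_mat ?m ?m" and SJS: "transpose_mat S * ?J * S = ?J"
    using assms by (auto simp: Sp_def)
  obtain T where T: "T \<in> carrier_mat ?m ?m" "S * T = 1\<^sub>m ?m" "T * S = 1\<^sub>m ?m"
    using Sp_inverse[OF assms] .
  have J: "?J \<in> carrier_mat ?m ?m" by simp
  have "transpose_mat S * ?J = transpose_mat S * ?J * (S * T)"
    using S T J by (simp add: square_mat_simps[of _ ?m])
  also have "\<dots> = (transpose_mat S * ?J * S) * T"
    using S T J by (simp add: square_mat_simps[of _ ?m])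
  finally have *: "transpose_mat S * ?J = ?J * T" using SJS by simp
  have "S * ?J * transpose_mat S * ?J = S * ?J * (transpose_mat S * ?J)"
    using S J by (simp add: square_mat_simps[of _ ?m])
  also have "\<dots> = S * (?J * ?J) * T"
    unfolding * using S T J by (simp add: square_mat_simps[of _ ?m])
  also have "\<dots> = - 1\<^sub>m ?m"
    using S T by (simp add: symplectic_J_squared)
  finally have eq: "S * ?J * transpose_mat S * ?J = - 1\<^sub>m ?m" .
  have "S * ?J * transpose_mat S = - (S * ?J * transpose_mat S * (?J * ?J))"
    using S J by (simp add: symplectic_J_squared square_mat_simps[of _ ?m])
  also have "\<dots> = - ((S * ?J * transpose_mat S * ?J) * ?J)"
    using S J by (simp add: square_mat_simps[of _ ?m])
  also have "\<dots> = ?J" unfolding eq using J by (simp add: square_mat_simps[of _ ?m])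
  finally show ?thesis using S by (simp add: Sp_def)
qed

lemma Sp_mult:
  assumes "S \<in> Sp n" "T \<in> Sp n"
  shows "S * T \<in> Sp n"
proof -
  let ?m = "2 * n" and ?J = "symplectic_J n"
  have S: "S \<in> carrier_mat ?m ?m" "transpose_mat S * ?J * S = ?J"
    and T: "T \<in> carrier_mat ?m ?m" "transpose_mat T * ?J * T = ?J"
    using assms by (auto simp: Sp_def)
  have J: "?J \<in> carrier_mat ?m ?m" by simp
  have "transpose_mat (S * T) * ?J * (S * T) = transpose_mat T * (transpose_mat S * ?J * S) * T"
    using S(1) T(1) J by (simp add: transpose_mult square_mat_simps[of _ ?m])
  also have "\<dots> = ?J" using S(2) T(2) by simp
  finally show ?thesis using S T by (simp add: Sp_def)
qed

lemma Sp_of_inverse: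
  assumes S: "S \<in> Sp n" and T: "T \<in> carrier_mat (2 * n) (2 * n)" and ST: "S * T = 1\<^sub>m (2 * n)"
  shows "T \<in> Sp n"
proof -
  let ?m = "2 * n" and ?J = "symplectic_J n"
  have c: "S \<in> carrier_mat ?m ?m" and SJS: "transpose_mat S * ?J * S = ?J"
    using S by (auto simp: Sp_def)
  have J: "?J \<in> carrier_mat ?m ?m" by simp
  have "transpose_mat T * ?J * T = transpose_mat T * (transpose_mat S * ?J * S) * T"
    by (simp add: SJS)
  also have "\<dots> = transpose_mat (S * T) * ?J * (S * T)"
    using T c J by (simp add: transpose_mult square_mat_simps[of _ ?m])
  also have "\<dots> = ?J" using J by (simp add: ST square_mat_simps[of _ ?m])
  finally show ?thesis using T by (simp add: Sp_def)
qed

lemma inv_mat_inverse: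
  assumes A: "A \<in> carrier_mat m m" and B: "B \<in> carrier_mat m m"
    and AB: "A * B = 1\<^sub>m m" and BA: "B * A = 1\<^sub>m m"
  shows "inv_mat A = B"
proof (cases "mat_inverse A")
  case None
  \<comment> \<open>An explicit two-sided inverse makes \<open>A\<close> a unit of the matrix ring,
    which the result \<open>None\<close> would rule out.\<close>
  have "A \<in> Units (ring_mat TYPE(real) m ())"
    using A B AB BA by (auto simp: Units_def ring_mat_def)
  with mat_inverse(1)[OF A None, of "()"] show ?thesis by blast
next
  case (Some C)
  from mat_inverse(2)[OF A this] have C: "C \<in> carrier_mat m m" "C * A = 1\<^sub>m m" by auto
  have "C = C * (A * B)" using C AB by (simp add: square_mat_simps[of _ m])
  also have "\<dots> = (C * A) * B" using A B C by (intro assoc_mult_mat[symmetric])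
  also have "\<dots> = B" using B C by (simp add: square_mat_simps[of _ m])
  finally show ?thesis using Some by (simp add: inv_mat_def)
qed

section \<open>Positive definite matrices\<close>

lemma sym_pos_def_one: "sym_pos_def m (1\<^sub>m m)"
proof -
  have "v \<bullet> v > 0" if "v \<in> carrier_vec m" "v \<noteq> 0\<^sub>v m" for v :: "real vec"
    using conjugate_square_greater_0_vec[OF that(1)] that(2) by simp
  then show ?thesis by (simp add: sym_pos_def_def)
qed

text \<open>The form of the new matrix at \<open>v\<close> is the form of \<open>G\<close> at
  \<open>T *\<^sub>v v\<close>, a nonzero vector because \<open>T\<close> has the left inverse
  \<open>S\<close>.\<close>

lemma sym_pos_def_congruence:
  assumes G: "sym_pos_def m G" and T: "T \<in> carrier_mat m m" and S: "S \<in> carrier_mat m m"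
    and ST: "S * T = 1\<^sub>m m"
  shows "sym_pos_def m (transpose_mat T * G * T)"
proof -
  have Gc: "G \<in> carrier_mat m m" and sym: "transpose_mat G = G" using G by (auto simp: sym_pos_def_def)
  have "v \<bullet> ((transpose_mat T * G * T) *\<^sub>v v) > 0" if v: "v \<in> carrier_vec m" "v \<noteq> 0\<^sub>v m" for v
  proof -
    have Tv: "T *\<^sub>v v \<in> carrier_vec m" using T v by simp
    have "S *\<^sub>v (T *\<^sub>v v) = v" using S T v ST by (simp flip: assoc_mult_mat_vec)
    moreover have "S *\<^sub>v 0\<^sub>v m = 0\<^sub>v m" using S by (intro eq_vecI) auto
    ultimately have "T *\<^sub>v v \<noteq> 0\<^sub>v m" using v(2) by auto
    then have "0 < (T *\<^sub>v v) \<bullet> (G *\<^sub>v (T *\<^sub>v v))" using G Tv by (auto simp: sym_pos_def_def)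
    also have "\<dots> = (transpose_mat T *\<^sub>v (G *\<^sub>v (T *\<^sub>v v))) \<bullet> v"
      using transpose_vec_mult_scalar[OF T v(1), of "G *\<^sub>v (T *\<^sub>v v)"] Gc Tv
      by (simp add: comm_scalar_prod[of _ m])
    also have "\<dots> = v \<bullet> ((transpose_mat T * G * T) *\<^sub>v v)"
      using Gc T v by (simp add: comm_scalar_prod[of _ m] assoc_mult_mat_vec[of _ m m _ m])
    finally show ?thesis .
  qed
  moreover have "transpose_mat (transpose_mat T * G * T) = transpose_mat T * G * T"
    using Gc T sym by (simp add: transpose_mult[of _ m m _ m] square_mat_simps[of _ m])
  ultimately show ?thesis using Gc T by (simp add: sym_pos_def_def)
qed

lemma mult_mat_unit_vec:
  fixes A :: "'a :: semiring_1 mat"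
  assumes "A \<in> carrier_mat n m" "j < m"
  shows "A *\<^sub>v unit_vec m j = col A j"
  using assms by (intro eq_vecI) auto

lemma sym_pos_def_diag_pos:
  assumes G: "sym_pos_def m G" and i: "i < m"
  shows "G $$ (i,i) > 0"
proof -
  have c: "G \<in> carrier_mat m m" using G by (simp add: sym_pos_def_def)
  have "unit_vec m i \<noteq> (0\<^sub>v m :: real vec)" using i by (metis index_unit_vec(1) index_zero_vec(1) zero_neq_one)
  then have "0 < unit_vec m i \<bullet> (G *\<^sub>v unit_vec m i)" using G by (auto simp: sym_pos_def_def)
  also have "\<dots> = G $$ (i,i)" using c i by (simp add: mult_mat_unit_vec[of _ m m])
  finally show ?thesis .
qed

text \<open>An involution other than the identity has an eigenvector \<open>w\<close> for the
  eigenvalue -1. Pairing \<open>P *\<^sub>v (R *\<^sub>v w) = - w\<close> with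
  \<open>R *\<^sub>v w\<close> equates a positive number with a negative one.\<close>

lemma sym_pos_def_mult_involution:
  assumes P: "sym_pos_def m P" and R: "sym_pos_def m R"
    and inv: "(P * R) * (P * R) = 1\<^sub>m m"
  shows "P * R = 1\<^sub>m m"
proof -
  have c: "P \<in> carrier_mat m m" "R \<in> carrier_mat m m" using P R by (auto simp: sym_pos_def_def)
  let ?Q = "P * R"
  have Q: "?Q \<in> carrier_mat m m" using c by simp
  have fixed: "?Q *\<^sub>v v = v" if v: "v \<in> carrier_vec m" for v
  proof (rule ccontr)
    assume ne: "?Q *\<^sub>v v \<noteq> v"
    \<comment> \<open>The involution exchanges \<open>v\<close> and its image, hence negates their
      difference.\<close>
    define w where "w = ?Q *\<^sub>v v - v"
    have w: "w \<in> carrier_vec m" using Q v by (simp add: w_def)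
    have Qv: "?Q *\<^sub>v v \<in> carrier_vec m" using Q v by simp
    have w0: "w \<noteq> 0\<^sub>v m"
    proof
      assume "w = 0\<^sub>v m"
      then have "?Q *\<^sub>v v = v"
        using v carrier_vecD[OF Qv] c unfolding w_def by (intro eq_vecI) (auto simp: vec_eq_iff)
      with ne show False ..
    qed
    have QQ: "?Q *\<^sub>v (?Q *\<^sub>v v) = v"
      using assoc_mult_mat_vec[OF Q Q v] inv v by simp
    have "?Q *\<^sub>v w = v - ?Q *\<^sub>v v"
      unfolding w_def mult_minus_distrib_mat_vec[OF Q Qv v] QQ ..
    also have "\<dots> = - w" unfolding w_def using v carrier_vecD[OF Qv] c by (intro eq_vecI) auto
    finally have Qw: "P *\<^sub>v (R *\<^sub>v w) = - w" using c w by simp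
    have Rw: "R *\<^sub>v w \<in> carrier_vec m" using c w by simp
    have pos: "w \<bullet> (R *\<^sub>v w) > 0" using R w w0 by (auto simp: sym_pos_def_def)
    then have "R *\<^sub>v w \<noteq> 0\<^sub>v m" using w by auto
    then have "0 < (R *\<^sub>v w) \<bullet> (P *\<^sub>v (R *\<^sub>v w))" using P Rw by (auto simp: sym_pos_def_def)
    also have "\<dots> = - (w \<bullet> (R *\<^sub>v w))" unfolding Qw using carrier_vecD[OF w] carrier_vecD[OF Rw]
      by (simp add: comm_scalar_prod[OF Rw uminus_carrier_vec[THEN iffD2, OF w]] del: dim_mult_mat_vec)
    finally show False using pos by simp
  qed
  show ?thesis
  proof (rule eq_matI)
    fix i j assume "i < dim_row (1\<^sub>m m :: real mat)" "j < dim_col (1\<^sub>m m :: real mat)"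
    then have ij: "i < m" "j < m" by auto
    have "?Q $$ (i,j) = col ?Q j $ i" using c ij by simp
    also have "\<dots> = unit_vec m j $ i"
      using fixed[of "unit_vec m j"] Q ij by (simp add: mult_mat_unit_vec[of _ m m])
    finally show "?Q $$ (i,j) = 1\<^sub>m m $$ (i,j)" using ij by simp
  qed (use c in auto)
qed

section \<open>Passing from \<open>G * J\<close> to the complex structure
  \<open>transpose_mat S * S * J\<close>\<close>

lemma commute_J_if_commute_diag_twice_J:
  assumes B: "B \<in> carrier_mat (2 * n) (2 * n)" and L: "L \<in> carrier_mat n n" "diagonal_mat L"
    and pos: "sym_pos_def (2 * n) (diag_twice L)"
    and comm: "B * (diag_twice L * symplectic_J n) = (diag_twice L * symplectic_J n) * B"
  shows "B * symplectic_J n = symplectic_J n * B"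
proof -
  let ?m = "2 * n" and ?J = "symplectic_J n" and ?D = "diag_twice L"
  have J: "?J \<in> carrier_mat ?m ?m" by simp
  have D: "?D \<in> carrier_mat ?m ?m" using pos by (simp add: sym_pos_def_def)
  define d where "d i = ?D $$ (i,i)" for i
  have dpos: "d i > 0" if "i < ?m" for i using sym_pos_def_diag_pos[OF pos that] by (simp add: d_def)
  have D_eq: "?D = mat_diag ?m d"
    using L D by (intro eq_matI)
      (auto simp: mat_diag_def d_def diag_twice_def diagonal_mat_def mult_2)
  have JD: "?J * ?D = ?D * ?J" using symplectic_J_commute_diag_twice[OF L(1)] by simp
  let ?X = "?D * ?J"
  have X: "?X \<in> carrier_mat ?m ?m" using D J by (simp add: square_mat_simps[of _ ?m])
  \<comment> \<open>Since \<open>D\<close> and \<open>J\<close> commute, the square of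
    \<open>D * J\<close> is minus the square of \<open>D\<close>, which is diagonal.\<close>
  have "?X * ?X = ?D * (?J * ?D) * ?J"
    using D J by (simp add: square_mat_simps[of _ ?m])
  also have "\<dots> = (?D * ?D) * (?J * ?J)"
    unfolding JD using D J by (simp add: square_mat_simps[of _ ?m])
  also have "\<dots> = - mat_diag ?m (\<lambda>i. d i * d i)"
    unfolding symplectic_J_squared D_eq mat_diag_diag by (simp add: square_mat_simps[of _ ?m])
  finally have XX: "?X * ?X = - mat_diag ?m (\<lambda>i. d i * d i)" .
  have "B * (?X * ?X) = (B * ?X) * ?X" using B X by (simp add: square_mat_simps[of _ ?m])
  also have "\<dots> = (?X * B) * ?X" by (simp only: comm)
  also have "\<dots> = ?X * (B * ?X)" using B X by (intro assoc_mult_mat)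
  also have "\<dots> = (?X * ?X) * B" unfolding comm using B X by (intro assoc_mult_mat[symmetric])
  finally have "- (B * mat_diag ?m (\<lambda>i. d i * d i)) = - (mat_diag ?m (\<lambda>i. d i * d i) * B)"
    unfolding XX using B by (simp add: square_mat_simps[of _ ?m])
  then have "B * mat_diag ?m (\<lambda>i. d i * d i) = mat_diag ?m (\<lambda>i. d i * d i) * B"
    by (metis uminus_uminus_mat)
  note zero = commute_diag_entry[OF B this]
  \<comment> \<open>Squaring is injective on positive numbers, so \<open>B\<close> commutes with the
    inverse of \<open>D\<close> as well; that inverse recovers \<open>J\<close> from
    \<open>D * J\<close>.\<close>
  have BE: "B * mat_diag ?m (\<lambda>i. 1 / d i) = mat_diag ?m (\<lambda>i. 1 / d i) * B"
  proof (rule commute_diag_if[OF B])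
    fix i j assume ij: "i < ?m" "j < ?m" and "1 / d i \<noteq> 1 / d j"
    then have "d i * d i \<noteq> d j * d j"
      using dpos[OF ij(1)] dpos[OF ij(2)] by (metis power2_eq_iff_nonneg power2_eq_square less_imp_le)
    then show "B $$ (i,j) = 0" by (rule zero[OF ij])
  qed
  define E where "E = mat_diag ?m (\<lambda>i. 1 / d i)"
  have E: "E \<in> carrier_mat ?m ?m" by (simp add: E_def)
  have ED: "E * ?D = 1\<^sub>m ?m"
    unfolding E_def D_eq mat_diag_diag using dpos by (intro eq_matI) (auto simp: mat_diag_def less_imp_neq[symmetric])
  have J_eq: "?J = E * ?X"
  proof -
    have "E * ?X = (E * ?D) * ?J" by (rule assoc_mult_mat[OF E D J, symmetric])
    then show ?thesis using J by (simp add: ED)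
  qed
  have "B * (E * ?X) = (B * E) * ?X" by (rule assoc_mult_mat[OF B E X, symmetric])
  also have "\<dots> = E * (B * ?X)" unfolding BE[folded E_def] by (rule assoc_mult_mat[OF E B X])
  also have "\<dots> = (E * ?X) * B" unfolding comm by (rule assoc_mult_mat[OF E X B, symmetric])
  finally show ?thesis by (simp flip: J_eq)
qed

text \<open>With \<open>Q\<close> the inverse of \<open>transpose_mat S\<close>, the matrices
  \<open>G * J\<close> and \<open>transpose_mat S * S * J\<close> are the conjugates of
  \<open>D * J\<close> and \<open>J\<close> by \<open>transpose_mat S\<close>. The previous lemma
  then applies to \<open>Q * B * transpose_mat S\<close>.\<close>

lemma commute_complex_structure:
  assumes B: "B \<in> carrier_mat (2 * n) (2 * n)" and S: "S \<in> Sp n"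
    and L: "L \<in> carrier_mat n n" "diagonal_mat L"
    and pos: "sym_pos_def (2 * n) (diag_twice L)"
    and comm: "B * (transpose_mat S * diag_twice L * S * symplectic_J n)
      = (transpose_mat S * diag_twice L * S * symplectic_J n) * B"
  shows "B * (transpose_mat S * S * symplectic_J n) = (transpose_mat S * S * symplectic_J n) * B"
proof -
  let ?m = "2 * n" and ?J = "symplectic_J n" and ?D = "diag_twice L" and ?P = "transpose_mat S"
  have J: "?J \<in> carrier_mat ?m ?m" by simp
  have D: "?D \<in> carrier_mat ?m ?m" using pos by (simp add: sym_pos_def_def)
  have Sc: "S \<in> carrier_mat ?m ?m" using S by (rule Sp_carrier)
  have P: "?P \<in> carrier_mat ?m ?m" using Sc by simp
  obtain Q where Q: "Q \<in> carrier_mat ?m ?m" and PQ: "?P * Q = 1\<^sub>m ?m" and QP: "Q * ?P = 1\<^sub>m ?m"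
    using Sp_inverse[OF Sp_transpose[OF S]] .
  have "S * ?J = S * ?J * (?P * Q)" using Sc J PQ by (simp add: square_mat_simps[of _ ?m])
  also have "\<dots> = (S * ?J * ?P) * Q"
    using Sc J P Q by (intro assoc_mult_mat[OF mult_carrier_mat[OF Sc J] P Q, symmetric])
  also have "\<dots> = ?J * Q" using Sp_transpose[OF S] by (simp add: Sp_def)
  finally have SJ: "S * ?J = ?J * Q" .
  \<comment> \<open>Used twice: \<open>Y = D\<close> rewrites the hypothesis and
    \<open>Y = 1\<close> rewrites the conclusion.\<close>
  have conj: "?P * Y * S * ?J = ?P * (Y * ?J) * Q" if Y: "Y \<in> carrier_mat ?m ?m" for Y
  proof -
    have "?P * Y * S * ?J = ?P * Y * (S * ?J)"
      using Sc J P Y by (simp add: square_mat_simps[of _ ?m])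
    then show ?thesis unfolding SJ using J P Q Y by (simp add: square_mat_simps[of _ ?m])
  qed
  let ?X = "?P * (?D * ?J) * Q" and ?B = "Q * B * ?P"
  have X: "?X \<in> carrier_mat ?m ?m" and DJ: "?D * ?J \<in> carrier_mat ?m ?m"
    and B': "?B \<in> carrier_mat ?m ?m"
    using B P Q D J by (simp_all add: square_mat_simps[of _ ?m])
  have "?B * (Q * ?X * ?P) = (Q * ?X * ?P) * ?B"
    by (rule conjugate_commute[OF B X P Q PQ]) (use comm conj[OF D] in simp)
  then have "?B * (?D * ?J) = (?D * ?J) * ?B"
    unfolding conjugate_inverse[OF DJ Q P QP] .
  then have "?B * ?J = ?J * ?B" by (rule commute_J_if_commute_diag_twice_J[OF B' L pos])
  from conjugate_commute[OF B' J Q P QP this]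
  have "B * (?P * ?J * Q) = (?P * ?J * Q) * B"
    unfolding conjugate_inverse[OF B P Q PQ] .
  moreover have "?P * S * ?J = ?P * ?J * Q"
    using conj[of "1\<^sub>m ?m"] P J by simp
  ultimately show ?thesis by simp
qed

section \<open>The determinant of an orthogonal symplectic matrix\<close>

text \<open>A symplectic orthogonal matrix commutes with \<open>J\<close>, hence has the block form
  \<open>[[A, B], [-B, A]]\<close>; over the complex numbers it is similar to a block triangular matrix with
  diagonal blocks \<open>A - iB\<close> and \<open>A + iB\<close>, so its determinant is \<open>\<bar>det (A + iB)\<bar>\<^sup>2\<close>.\<close>

lemma det_commute_J_nonneg:
  assumes U: "U \<in> carrier_mat (2 * n) (2 * n)" and comm: "U * symplectic_J n = symplectic_J n * U"
  shows "det U \<ge> 0"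
proof -
  obtain A B C E where split: "split_block U n n = (A, B, C, E)" by (cases "split_block U n n")
  have c: "A \<in> carrier_mat n n" "B \<in> carrier_mat n n" "C \<in> carrier_mat n n" "E \<in> carrier_mat n n"
    and U_eq: "U = four_block_mat A B C E"
    using split_block[OF split, of n n] U by (auto simp: mult_2)
  have UJ: "U * symplectic_J n = four_block_mat (- B) A (- E) C"
    unfolding U_eq symplectic_J_def using c
    by (subst mult_four_block_mat[of _ n n _ n _ n _ _ n _ n]) auto
  have JU: "symplectic_J n * U = four_block_mat C E (- A) (- B)"
    unfolding U_eq symplectic_J_def using c
    by (subst mult_four_block_mat[of _ n n _ n _ n _ _ n _ n]) auto
  have entry: "C $$ (i,j) = - B $$ (i,j) \<and> E $$ (i,j) = A $$ (i,j)" if "i < n" "j < n" for i j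
  proof -
    have eq: "four_block_mat (- B) A (- E) C $$ p = four_block_mat C E (- A) (- B) $$ p" for p
      using comm UJ JU by simp
    show ?thesis using eq[of "(i, j)"] eq[of "(i, j + n)"] c that by simp
  qed
  let ?h = "map_mat complex_of_real"
  \<comment> \<open>\<open>Z\<close> is A + iB and \<open>Y\<close> is its entrywise conjugate A -
    iB.\<close>
  define Z where "Z = mat n n (\<lambda>(i,j). Complex (A $$ (i,j)) (B $$ (i,j)))"
  define Y where "Y = map_mat cnj Z"
  have ZY: "Z \<in> carrier_mat n n" "Y \<in> carrier_mat n n" by (auto simp: Z_def Y_def)
  have hc: "?h A \<in> carrier_mat n n" "?h B \<in> carrier_mat n n" "?h C \<in> carrier_mat n n" "?h E \<in> carrier_mat n n"
    using c by auto
  have hU: "?h U = four_block_mat (?h A) (?h B) (?h C) (?h E)"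
    unfolding U_eq using map_four_block_mat[OF c(1-3), of E] c by auto
  \<comment> \<open>Multiplying by \<open>?K \<i>\<close> on the left adds i times the lower block
    row to the upper one, turning the latter into (Y, iY); multiplying by \<open>?K (- \<i>)\<close>
    on the right then clears the upper right block.\<close>
  let ?K = "\<lambda>z. four_block_mat (1\<^sub>m n) (z \<cdot>\<^sub>m 1\<^sub>m n) (0\<^sub>m n n) (1\<^sub>m n :: complex mat)"
  have Kc: "?K z \<in> carrier_mat (n + n) (n + n)" for z by auto
  have hUc: "?h U \<in> carrier_mat (n + n) (n + n)" using U by (auto simp: mult_2)
  have detK: "det (?K z) = 1" for z
    by (subst det_four_block_mat_lower_left_zero[of _ n _ n]) auto
  have "?K \<i> * ?h U = four_block_mat (1\<^sub>m n * ?h A + (\<i> \<cdot>\<^sub>m 1\<^sub>m n) * ?h C)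
      (1\<^sub>m n * ?h B + (\<i> \<cdot>\<^sub>m 1\<^sub>m n) * ?h E) (0\<^sub>m n n * ?h A + 1\<^sub>m n * ?h C) (0\<^sub>m n n * ?h B + 1\<^sub>m n * ?h E)"
    unfolding hU by (rule mult_four_block_mat) (use hc in auto)
  also have "1\<^sub>m n * ?h A + (\<i> \<cdot>\<^sub>m 1\<^sub>m n) * ?h C = Y"
    unfolding left_mult_one_mat[OF hc(1)] left_mult_one_mat[OF hc(2)] left_mult_one_mat[OF hc(3)]
      left_mult_one_mat[OF hc(4)] mult_smult_assoc_mat[OF one_carrier_mat hc(3)]
      mult_smult_assoc_mat[OF one_carrier_mat hc(4)]
    using c by (intro eq_matI) (simp_all add: entry complex_eq_iff Y_def Z_def)
  also have "1\<^sub>m n * ?h B + (\<i> \<cdot>\<^sub>m 1\<^sub>m n) * ?h E = \<i> \<cdot>\<^sub>m Y"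
    unfolding left_mult_one_mat[OF hc(1)] left_mult_one_mat[OF hc(2)] left_mult_one_mat[OF hc(3)]
      left_mult_one_mat[OF hc(4)] mult_smult_assoc_mat[OF one_carrier_mat hc(3)]
      mult_smult_assoc_mat[OF one_carrier_mat hc(4)]
    using c by (intro eq_matI) (simp_all add: entry complex_eq_iff Y_def Z_def)
  also have "0\<^sub>m n n * ?h A + 1\<^sub>m n * ?h C = ?h C" using hc by simp
  also have "0\<^sub>m n n * ?h B + 1\<^sub>m n * ?h E = ?h E" using hc by simp
  finally have KU: "?K \<i> * ?h U = four_block_mat Y (\<i> \<cdot>\<^sub>m Y) (?h C) (?h E)" .
  have "?K \<i> * ?h U * ?K (- \<i>) = four_block_mat (Y * 1\<^sub>m n + (\<i> \<cdot>\<^sub>m Y) * 0\<^sub>m n n)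
      (Y * (- \<i> \<cdot>\<^sub>m 1\<^sub>m n) + (\<i> \<cdot>\<^sub>m Y) * 1\<^sub>m n) (?h C * 1\<^sub>m n + ?h E * 0\<^sub>m n n)
      (?h C * (- \<i> \<cdot>\<^sub>m 1\<^sub>m n) + ?h E * 1\<^sub>m n)"
    unfolding KU by (rule mult_four_block_mat) (use hc ZY in auto)
  also have "Y * 1\<^sub>m n + (\<i> \<cdot>\<^sub>m Y) * 0\<^sub>m n n = Y" using ZY by simp
  also have "Y * (- \<i> \<cdot>\<^sub>m 1\<^sub>m n) + (\<i> \<cdot>\<^sub>m Y) * 1\<^sub>m n = 0\<^sub>m n n"
    unfolding mult_smult_distrib[OF ZY(2) one_carrier_mat] mult_smult_assoc_mat[OF ZY(2) one_carrier_mat]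
      right_mult_one_mat[OF ZY(2)]
    using ZY by (intro eq_matI) simp_all
  also have "?h C * 1\<^sub>m n + ?h E * 0\<^sub>m n n = ?h C" using hc by simp
  also have "?h C * (- \<i> \<cdot>\<^sub>m 1\<^sub>m n) + ?h E * 1\<^sub>m n = Z"
    unfolding mult_smult_distrib[OF hc(3) one_carrier_mat] right_mult_one_mat[OF hc(3)]
      right_mult_one_mat[OF hc(4)]
    using c by (intro eq_matI) (simp_all add: entry complex_eq_iff Z_def)
  finally have "?K \<i> * ?h U * ?K (- \<i>) = four_block_mat Y (0\<^sub>m n n) (?h C) Z" .
  then have "det (?K \<i> * ?h U * ?K (- \<i>)) = det Y * det Z"
    using hc ZY by (simp add: det_four_block_mat_upper_right_zero[of _ n _ n])
  moreover have "det (?K \<i> * ?h U * ?K (- \<i>)) = det (?h U)"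
    using det_mult[of "?K \<i> * ?h U" "n + n" "?K (- \<i>)"] det_mult[of "?K \<i>" "n + n" "?h U"]
      hUc Kc mult_carrier_mat[OF Kc hUc] by (simp add: detK del: of_real_hom.hom_det)
  moreover have "det (?h U) = complex_of_real (det U)" by (rule of_real_hom.hom_det)
  moreover have "det Y = cnj (det Z)"
  proof -
    interpret cnj: comm_ring_hom cnj by unfold_locales auto
    show ?thesis unfolding Y_def by (rule cnj.hom_det)
  qed
  ultimately have "complex_of_real (det U) = cnj (det Z) * det Z" by simp
  also have "\<dots> = complex_of_real ((cmod (det Z))\<^sup>2)"
    by (simp only: complex_norm_square mult.commute)
  finally have "det U = (cmod (det Z))\<^sup>2" by (simp only: of_real_eq_iff)
  then show ?thesis by simp
qed

text \<open>Orthogonality turns the symplectic relation into commutation with \<open>J\<close>, so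
  the determinant is nonnegative; its square is 1.\<close>

lemma orthogonal_symplectic_in_SO:
  assumes U: "U \<in> Sp n" and orth: "transpose_mat U * U = 1\<^sub>m (2 * n)"
  shows "U \<in> SO (2 * n)"
proof -
  let ?m = "2 * n" and ?J = "symplectic_J n"
  have Uc: "U \<in> carrier_mat ?m ?m" and UJU: "transpose_mat U * ?J * U = ?J"
    using U by (auto simp: Sp_def)
  have J: "?J \<in> carrier_mat ?m ?m" by simp
  have UU: "U * transpose_mat U = 1\<^sub>m ?m"
    by (rule mat_mult_left_right_inverse[OF _ Uc orth]) (use Uc in simp)
  have "U * ?J = U * (transpose_mat U * ?J * U)" by (simp only: UJU)
  also have "\<dots> = (U * transpose_mat U) * (?J * U)"
    using Uc J by (simp add: square_mat_simps[of _ ?m])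
  also have "\<dots> = ?J * U" using Uc J by (simp add: UU square_mat_simps[of _ ?m])
  finally have "det U \<ge> 0" by (rule det_commute_J_nonneg[OF Uc])
  moreover have "det U * det U = 1"
    using det_mult[of "transpose_mat U" ?m U] det_transpose[OF Uc] Uc by (simp add: orth)
  then have "\<bar>det U\<bar> = 1" using abs_square_eq_1[of "det U"] by (simp add: power2_eq_square)
  ultimately show ?thesis using Uc orth by (simp add: SO_def)
qed

section \<open>Comparison of the two Gram matrices and conclusion\<close>

lemma commute_mult_J_if_invariant:
  assumes M: "M \<in> Sp n" and G: "G \<in> carrier_mat (2 * n) (2 * n)"
    and inv: "M * G * transpose_mat M = G"
  shows "M * (G * symplectic_J n) = (G * symplectic_J n) * M"
proof -
  let ?m = "2 * n" and ?J = "symplectic_J n"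
  have Mc: "M \<in> carrier_mat ?m ?m" and MJM: "transpose_mat M * ?J * M = ?J"
    using M by (auto simp: Sp_def)
  have J: "?J \<in> carrier_mat ?m ?m" by simp
  have "M * (G * ?J) = M * (G * (transpose_mat M * ?J * M))" by (simp only: MJM)
  also have "\<dots> = (M * G * transpose_mat M) * (?J * M)"
    using Mc G J by (simp add: square_mat_simps[of _ ?m])
  also have "\<dots> = (G * ?J) * M" unfolding inv using Mc G J by (simp add: square_mat_simps[of _ ?m])
  finally show ?thesis .
qed

lemma sym_pos_def_symplectic_eq_if_commute:
  assumes P: "sym_pos_def (2 * n) P" "P \<in> Sp n" and R: "sym_pos_def (2 * n) R" "R \<in> Sp n"
    and comm: "(P * symplectic_J n) * (R * symplectic_J n) = (R * symplectic_J n) * (P * symplectic_J n)"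
  shows "P = R"
proof -
  let ?m = "2 * n" and ?J = "symplectic_J n"
  have J: "?J \<in> carrier_mat ?m ?m" by simp
  have c: "P \<in> carrier_mat ?m ?m" "R \<in> carrier_mat ?m ?m" using P R by (auto simp: sym_pos_def_def)
  \<comment> \<open>Symmetry of \<open>X\<close> turns the symplectic relation into
    \<open>X * J * X = J\<close>.\<close>
  have square: "(X * ?J) * (X * ?J) = - 1\<^sub>m ?m" if X: "sym_pos_def ?m X" "X \<in> Sp n" for X
  proof -
    have Xc: "X \<in> carrier_mat ?m ?m" and "X * ?J * X = ?J"
      using X by (auto simp: sym_pos_def_def Sp_def)
    moreover have "(X * ?J) * (X * ?J) = (X * ?J * X) * ?J"
      using Xc J by (simp add: square_mat_simps[of _ ?m])
    ultimately show ?thesis by (simp add: symplectic_J_squared)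
  qed
  let ?X = "P * ?J" and ?Y = "R * ?J"
  have X: "?X \<in> carrier_mat ?m ?m" and Y: "?Y \<in> carrier_mat ?m ?m"
    using c J by (simp_all add: square_mat_simps[of _ ?m])
  \<comment> \<open>\<open>T\<close> is congruent to \<open>R\<close>, hence positive definite, and
    is chosen so that \<open>P * T\<close> is minus the product of the two complex
    structures.\<close>
  define T where "T = transpose_mat ?J * R * ?J"
  have T: "sym_pos_def ?m T" unfolding T_def
    by (rule sym_pos_def_congruence[OF R(1) J, of "- ?J"])
      (use J in \<open>simp_all add: symplectic_J_squared square_mat_simps[of _ ?m]\<close>)
  have PT: "P * T = - (?X * ?Y)"
    using c J by (simp add: T_def transpose_symplectic_J square_mat_simps[of _ ?m])
  have XY: "?X * ?Y \<in> carrier_mat ?m ?m" using X Y by (simp add: square_mat_simps[of _ ?m])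
  have "(?X * ?Y) * (?X * ?Y) = (?X * ?Y) * (?Y * ?X)" by (simp only: comm)
  also have "\<dots> = ?X * (?Y * ?Y) * ?X"
    using X Y by (simp add: assoc_mult_mat[of _ ?m ?m _ ?m _ ?m] mult_carrier_mat[of _ ?m ?m _ ?m])
  also have "\<dots> = 1\<^sub>m ?m"
    unfolding square[OF R] using X square[OF P] by (simp add: square_mat_simps[of _ ?m])
  finally have "(P * T) * (P * T) = 1\<^sub>m ?m"
    unfolding PT using XY by (simp add: uminus_mult_square_mat[of _ ?m] uminus_carrier_mat)
  from sym_pos_def_mult_involution[OF P(1) T this] have "- (?X * ?Y) = 1\<^sub>m ?m" unfolding PT .
  then have XY1: "?X * ?Y = - 1\<^sub>m ?m" by (metis uminus_uminus_mat)
  \<comment> \<open>Multiplying \<open>?X * ?Y = -1\<close> by \<open>?X\<close>, whose square is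
    \<open>-1\<close>, identifies the two complex structures; cancelling \<open>J\<close> then
    identifies \<open>P\<close> and \<open>R\<close>.\<close>
  have "(?X * ?X) * ?Y = ?X * (?X * ?Y)" by (rule assoc_mult_mat[OF X X Y])
  then have "- ?Y = - ?X"
    unfolding square[OF P] XY1 using X Y by (simp add: square_mat_simps[of _ ?m])
  then have "?Y = ?X" by (metis uminus_uminus_mat)
  then have "(R * ?J) * ?J = (P * ?J) * ?J" by simp
  then have "R * (?J * ?J) = P * (?J * ?J)"
    unfolding assoc_mult_mat[OF c(1) J J] assoc_mult_mat[OF c(2) J J] .
  then have "- R = - P" using c by (simp add: symplectic_J_squared square_mat_simps[of _ ?m])
  then show ?thesis by (metis uminus_uminus_mat)
qed

text \<open>Distinctness of the eigenvalues is expressed by counting: the spectrum of the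
  complexified matrix, as a set, has as many elements as the matrix has rows.\<close>

theorem mainTheorem1:
  fixes n :: nat
    and M G1 G2 S1 S2 D1 D2 L1 L2 :: "real mat"
  assumes M: "M \<in> Sp n"
    and distinct_eigenvalues: "card (spectrum (map_mat complex_of_real M)) = 2 * n"
    and G1: "sym_pos_def (2 * n) G1"
    and G2: "sym_pos_def (2 * n) G2"
    and MG1: "M * G1 * transpose_mat M = G1"
    and MG2: "M * G2 * transpose_mat M = G2"
    and S1: "S1 \<in> Sp n"
    and S2: "S2 \<in> Sp n"
    and L1: "L1 \<in> carrier_mat n n" "diagonal_mat L1"
    and L2: "L2 \<in> carrier_mat n n" "diagonal_mat L2"
    and D1: "D1 = diag_twice L1"
    and D2: "D2 = diag_twice L2"
    and G1_eq: "G1 = transpose_mat S1 * D1 * S1"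
    and G2_eq: "G2 = transpose_mat S2 * D2 * S2"
  shows "S2 * inv_mat S1 \<in> SO (2 * n)"
proof -
  let ?m = "2 * n" and ?J = "symplectic_J n"
  have J: "?J \<in> carrier_mat ?m ?m" by simp
  have Mc: "M \<in> carrier_mat ?m ?m" using M by (rule Sp_carrier)
  have S1c: "S1 \<in> carrier_mat ?m ?m" and S2c: "S2 \<in> carrier_mat ?m ?m"
    using S1 S2 by (auto dest: Sp_carrier)
  have Gc: "G1 \<in> carrier_mat ?m ?m" "G2 \<in> carrier_mat ?m ?m"
    using G1 G2 by (auto simp: sym_pos_def_def)
  have comm: "(G1 * ?J) * (G2 * ?J) = (G2 * ?J) * (G1 * ?J)"
    using real_commute_if_commute_distinct_eigenvalues[OF Mc distinct_eigenvalues]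
      commute_mult_J_if_invariant[OF M Gc(1) MG1] commute_mult_J_if_invariant[OF M Gc(2) MG2]
      mult_carrier_mat[OF Gc(1) J] mult_carrier_mat[OF Gc(2) J] by blast
  \<comment> \<open>Positivity of the diagonal factor is inherited from \<open>G\<close>: congruence
    by the inverse of \<open>S\<close> turns \<open>G\<close> back into it.\<close>
  have diag_pos: "sym_pos_def ?m (diag_twice L)"
    if G: "sym_pos_def ?m G" "G = transpose_mat S * diag_twice L * S"
      and S: "S \<in> Sp n" and L: "L \<in> carrier_mat n n" for G S L
  proof -
    have Sc: "S \<in> carrier_mat ?m ?m" using S by (rule Sp_carrier)
    have D: "diag_twice L \<in> carrier_mat ?m ?m" using L by (auto simp: diag_twice_def mult_2)
    obtain T where T: "T \<in> carrier_mat ?m ?m" "S * T = 1\<^sub>m ?m" "T * S = 1\<^sub>m ?m"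
      using Sp_inverse[OF S] .
    have "transpose_mat T * G * T = transpose_mat (S * T) * diag_twice L * (S * T)"
      unfolding G(2) transpose_mult[OF Sc T(1)] using Sc D T(1) by (simp add: square_mat_simps[of _ ?m])
    also have "\<dots> = diag_twice L" using D by (simp add: T(2) square_mat_simps[of _ ?m])
    finally show ?thesis using sym_pos_def_congruence[OF G(1) T(1) Sc T(2)] by (simp only:)
  qed
  note pos1 = diag_pos[OF G1 G1_eq[unfolded D1] S1 L1(1)]
    and pos2 = diag_pos[OF G2 G2_eq[unfolded D2] S2 L2(1)]
  let ?P1 = "transpose_mat S1 * S1" and ?P2 = "transpose_mat S2 * S2"
  have P1c: "?P1 * ?J \<in> carrier_mat ?m ?m" using S1c J by (simp add: square_mat_simps[of _ ?m])
  have G2J: "G2 * ?J \<in> carrier_mat ?m ?m" using Gc J by (simp add: square_mat_simps[of _ ?m])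
  \<comment> \<open>The Gram matrices are introduced one at a time: first \<open>?P1\<close>
    replaces \<open>G1\<close> with \<open>G2 * J\<close> as the commuting matrix, then
    \<open>?P2\<close> replaces \<open>G2\<close> with \<open>?P1 * J\<close> in that role.\<close>
  have "(G2 * ?J) * (?P1 * ?J) = (?P1 * ?J) * (G2 * ?J)"
    using commute_complex_structure[OF G2J S1 L1 pos1, folded D1, folded G1_eq, OF comm[symmetric]] .
  then have "(?P1 * ?J) * (G2 * ?J) = (G2 * ?J) * (?P1 * ?J)" ..
  from commute_complex_structure[OF P1c S2 L2 pos2, folded D2, folded G2_eq, OF this]
  have commP: "(?P1 * ?J) * (?P2 * ?J) = (?P2 * ?J) * (?P1 * ?J)" .
  have gram: "sym_pos_def ?m (transpose_mat S * S)" "transpose_mat S * S \<in> Sp n"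
    if S: "S \<in> Sp n" for S
  proof -
    have Sc: "S \<in> carrier_mat ?m ?m" using S by (rule Sp_carrier)
    obtain T where "T \<in> carrier_mat ?m ?m" "T * S = 1\<^sub>m ?m" using Sp_inverse[OF S] .
    from sym_pos_def_congruence[OF sym_pos_def_one Sc this]
    show "sym_pos_def ?m (transpose_mat S * S)"
      unfolding right_mult_one_mat[OF transpose_carrier_mat[THEN iffD2, OF Sc]] .
    show "transpose_mat S * S \<in> Sp n" by (rule Sp_mult[OF Sp_transpose[OF S] S])
  qed
  have P_eq: "?P1 = ?P2"
    by (rule sym_pos_def_symplectic_eq_if_commute[OF gram[OF S1] gram[OF S2] commP])
  obtain T where T: "T \<in> carrier_mat ?m ?m" "S1 * T = 1\<^sub>m ?m" "T * S1 = 1\<^sub>m ?m"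
    using Sp_inverse[OF S1] .
  have inv: "inv_mat S1 = T" by (rule inv_mat_inverse[OF S1c T])
  \<comment> \<open>Equal Gram matrices make \<open>S2 * T\<close> as orthogonal as
    \<open>S1 * T\<close>, which is the identity.\<close>
  have "transpose_mat (S2 * T) * (S2 * T) = transpose_mat T * ?P2 * T"
    unfolding transpose_mult[OF S2c T(1)] using S2c T(1) by (simp add: square_mat_simps[of _ ?m])
  also have "\<dots> = transpose_mat (S1 * T) * (S1 * T)"
    unfolding P_eq[symmetric] transpose_mult[OF S1c T(1)]
    using S1c T(1) by (simp add: square_mat_simps[of _ ?m])
  also have "\<dots> = 1\<^sub>m ?m" by (simp add: T(2))
  finally show ?thesis unfolding inv
    by (intro orthogonal_symplectic_in_SO Sp_mult S2 Sp_of_inverse[OF S1 T(1,2)])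
qed

end
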